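(* Let $\mathbb{F}$ be a field of characteristic $p$ and let $q = p^k$. Suppose $T: \mathbb{F}[y] \to \mathbb{F}[y]$ is an $\mathbb{F}$-linear operator such that: (1) there is an integer $E \geq 1$ with $\deg T(f) \leq \deg f - E$ for all $f \in \mathbb{F}[y]$; (2) the sequence $\{T(y^n)\}_n$ satisfies a linear recursion whose companion polynomial has the form $$P = (X + c y)^d + (\text{terms of total degree} \leq d - D) \in \mathbb{F}[y][X]$$ for some $d \leq q$, some $D \geq 1$ with $q - D \geq 2$, and some $c \in \mathbb{F}$. Then for all $f \in \mathbb{F}[y]$, $$N_T(f) \leq \frac{(q-D)(q-1)}{E(q-D-1)} (\deg f)^{\log(q-D)/\log q}.$$
   Context: A sequence $\{s_n\}$ in $\mathbb{F}[y]$ satisfies the linear recursion with companion polynomial $X^d - a_1X^{d-1} - \cdots - a_d \in \mathbb{F}[y][X]$ if $s_n = a_1 s_{n-1} + \cdots + a_d s_{n-d}$ for all $n \geq d$. Total degree is in $y, X$. $\deg 0 = -\infty$. For $f \neq 0$, $N_T(f) := \max\{k \geq 0 : T^k f \neq 0\}$, and $N_T(0) = -\infty$. *)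

theory Defs
  imports
    Complex_Main
    "HOL-Library.Extended_Real"
    "HOL-Computational_Algebra.Computational_Algebra"
begin

(* F[y] is 'a poly and F[y][X] is 'a poly poly: the outer variable is X, the inner one is y. *)

(* Unlike the library's degree, this one takes the value -\<infinity> at 0. *)
definition edegree :: "'a::zero poly \<Rightarrow> ereal" where
  "edegree f = (if f = 0 then -\<infinity> else ereal (real (degree f)))"

(* coeff (coeff P j) i is the coefficient of y^i X^j. *)
definition total_degree :: "'a::zero poly poly \<Rightarrow> ereal" where
  "total_degree P =
     (if P = 0 then -\<infinity>
      else ereal (real (Max {i + j | i j. coeff (coeff P j) i \<noteq> 0})))"

definition companion_poly :: "nat \<Rightarrow> (nat \<Rightarrow> 'a::comm_ring_1 poly) \<Rightarrow> 'a poly poly" where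
  "companion_poly d a = monom 1 d - (\<Sum>i=1..d. monom (a i) (d - i))"

(* Only the values a 1, ..., a d matter. *)
definition satisfies_recursion ::
    "nat \<Rightarrow> (nat \<Rightarrow> 'a::comm_ring_1 poly) \<Rightarrow> (nat \<Rightarrow> 'a poly) \<Rightarrow> bool" where
  "satisfies_recursion d a s \<longleftrightarrow> (\<forall>n\<ge>d. s n = (\<Sum>i=1..d. a i * s (n - i)))"

(* For f \<noteq> 0 this is the intended maximum only if T is nilpotent at f; see finite_nonvanishing. *)
definition nilpotence_order :: "('a::zero poly \<Rightarrow> 'a poly) \<Rightarrow> 'a poly \<Rightarrow> ereal" where
  "nilpotence_order T f =
     (if f = 0 then -\<infinity> else ereal (real (Max {k. (T ^^ k) f \<noteq> 0})))"

(* Real powers of degrees, with the convention (-\<infinity>)^r = -\<infinity> for the zero polynomial.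
   The value at \<infinity>, which is not a degree, is immaterial. *)
definition epowr :: "ereal \<Rightarrow> real \<Rightarrow> ereal" where
  "epowr x r = (if x = -\<infinity> then -\<infinity> else ereal (real_of_ereal x powr r))"

lemma finite_nonvanishing:
  fixes T :: "'a::zero poly \<Rightarrow> 'a poly" and E :: nat
  assumes E: "E \<ge> 1" and T: "\<And>f. edegree (T f) \<le> edegree f - ereal (real E)"
  shows "finite {k. (T ^^ k) f \<noteq> 0}"
proof -
  have T0: "T 0 = 0"
    using T[of 0] by (simp add: edegree_def split: if_splits)
  have drop: "g \<noteq> 0 \<and> degree (T g) < degree g" if "T g \<noteq> 0" for g
    using that T[of g] T0 E by (auto simp: edegree_def split: if_splits)
  have "(T ^^ k) f \<noteq> 0 \<longrightarrow> degree ((T ^^ k) f) + k \<le> degree f" for k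
  proof (induction k)
    case (Suc k)
    then show ?case using drop[of "(T ^^ k) f"] by auto
  qed simp
  then have "{k. (T ^^ k) f \<noteq> 0} \<subseteq> {..degree f}"
    by (auto intro: add_leD2)
  then show ?thesis
    using finite_subset by blast
qed

lemma finite_total_degrees: "finite {i + j | i j. coeff (coeff P j) i \<noteq> 0}"
proof -
  have "{i + j | i j. coeff (coeff P j) i \<noteq> 0}
          \<subseteq> (\<Union>j\<in>{..degree P}. (\<lambda>i. i + j) ` {..degree (coeff P j)})"
  proof clarify
    fix i j
    assume nz: "coeff (coeff P j) i \<noteq> 0"
    then have "coeff P j \<noteq> 0"
      by auto
    then have "j \<le> degree P"
      by (rule le_degree)
    with nz show "i + j \<in> (\<Union>j\<in>{..degree P}. (\<lambda>i. i + j) ` {..degree (coeff P j)})"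
      by (auto intro: le_degree)
  qed
  then show ?thesis
    by (rule finite_subset) auto
qed

end

theory Submission
  imports Defs
begin

text \<open>
  Put \<open>b = q - D\<close> and let the content of \<open>n\<close> be its base-\<open>q\<close> expansion read at \<open>b\<close> instead
  of \<open>q\<close>. Content is subadditive, is of order \<open>n powr (ln b / ln q)\<close>, and drops by at least \<open>E\<close>
  under \<open>T\<close>, so the nilpotence order is at most the largest content divided by \<open>E\<close>.
  For the drop, multiply \<open>P\<close> by \<open>(X + c y)^(q - d)\<close> and raise the product to the power \<open>q^j\<close>,
  where \<open>q^(j+1)\<close> is the leading place of \<open>n\<close>. By Frobenius the resulting recursion for \<open>T (y^n)\<close>
  only has terms \<open>y^(u q^j) T (y^(n - q^(j+1) + v q^j))\<close> with \<open>u + v \<le> b\<close>, besides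
  \<open>y^(q^(j+1)) T (y^(n - q^(j+1)))\<close>. Removing the leading \<open>q^(j+1)\<close> lowers the content by
  \<open>b^(j+1)\<close>, which pays for what \<open>u q^j\<close> and \<open>v q^j\<close> add back.
\<close>

section \<open>The content of a natural number\<close>

text \<open>The base-\<open>q\<close> expansion of the argument, evaluated at \<open>b\<close>.
  Bases \<open>q \<le> 1\<close> are junk.\<close>
function content :: "nat \<Rightarrow> nat \<Rightarrow> nat \<Rightarrow> nat" where
  "content b q n = (if n = 0 \<or> q \<le> 1 then 0 else n mod q + b * content b q (n div q))"
  by auto
termination
  by (relation "measure (\<lambda>(b, q, n). n)") auto

declare content.simps [simp del]

lemma content_0 [simp]: "content b q 0 = 0"
  by (simp add: content.simps)

lemma content_rec: "q \<ge> 2 \<Longrightarrow> content b q n = n mod q + b * content b q (n div q)"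
  by (cases "n = 0") (simp_all add: content.simps[of b q n])

lemma content_less: "n < q \<Longrightarrow> q \<ge> 2 \<Longrightarrow> content b q n = n"
  by (subst content_rec) simp_all

lemma content_mult_power:
  assumes "q \<ge> 2"
  shows "content b q (q ^ j * n) = b ^ j * content b q n"
proof (induction j)
  case (Suc j)
  have "content b q (q ^ Suc j * n) = b * content b q (q ^ j * n)"
    using assms by (subst content_rec) (simp_all add: mult.assoc)
  then show ?case
    by (simp add: Suc.IH)
qed simp

text \<open>A carry trades \<open>q\<close> units of one digit for one unit of the next one,
  which is worth only \<open>b \<le> q\<close>.\<close>
lemma content_add_le:
  assumes q: "q \<ge> 2" and bq: "b \<le> q"
  shows "content b q (m + n) \<le> content b q m + content b q n"
proof (induction "m + n" arbitrary: m n rule: less_induct)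
  case less
  let ?c = "content b q"
  show ?case
  proof (cases "m + n = 0")
    case False
    \<comment> \<open>\<open>u\<close> is the carry out of the last digit. The induction hypothesis
      first splits it off the two quotients and then separates these.\<close>
    define u where "u = (m mod q + n mod q) div q"
    have u1: "u \<le> 1"
    proof -
      have "m mod q < q" "n mod q < q"
        using q by simp_all
      then have "m mod q + n mod q < 2 * q"
        by linarith
      then have "u < 2"
        unfolding u_def by (rule less_mult_imp_div_less)
      then show ?thesis
        by simp
    qed
    have divq: "(m + n) div q = m div q + n div q + u"
      unfolding u_def by (rule div_add1_eq)
    have modq: "(m + n) mod q + q * u = m mod q + n mod q"
      unfolding u_def by (metis mod_add_eq mod_mult_div_eq)
    have lt: "m div q + n div q + u < m + n"
      unfolding divq[symmetric] using False q by (simp add: div_less_dividend)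
    then have lt': "m div q + n div q < m + n"
      by simp
    have "?c (m div q + n div q + u) \<le> ?c (m div q + n div q) + ?c u"
      using less lt by blast
    also have "?c (m div q + n div q) \<le> ?c (m div q) + ?c (n div q)"
      using less lt' by blast
    also have "?c u = u"
      using u1 q by (intro content_less) simp_all
    finally have "b * ?c (m div q + n div q + u) \<le> b * (?c (m div q) + ?c (n div q) + u)"
      by simp
    moreover have "b * u \<le> q * u"
      using bq by (rule mult_le_mono1)
    ultimately have "(m + n) mod q + b * ?c ((m + n) div q)
        \<le> (m mod q + b * ?c (m div q)) + (n mod q + b * ?c (n div q))"
      unfolding divq distrib_left using modq by linarith
    then show ?thesis
      using content_rec[OF q] by metis
  qed simp
qed

text \<open>\<open>n\<close> is a sum of \<open>n\<close> ones, each of content 1, so subadditivity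
  suffices.\<close>

lemma content_le_self: "content b q n \<le> n" if "q \<ge> 2" "b \<le> q"
proof (induction n)
  case (Suc n)
  have "content b q (n + 1) \<le> content b q n + content b q 1"
    using that by (rule content_add_le)
  then show ?case
    using Suc content_less[of 1 q b] that by simp
qed simp

text \<open>\<open>q ^ j\<close> is the leading place of \<open>n\<close>, so the digit there is
  positive and the subtraction changes no other digit.\<close>

lemma content_diff_power:
  assumes q: "q \<ge> 2"
  shows "q ^ j \<le> n \<Longrightarrow> n < q ^ Suc j \<Longrightarrow> content b q n = content b q (n - q ^ j) + b ^ j"
proof (induction j arbitrary: n)
  case 0
  then show ?case
    using q by (simp add: content_less)
next
  case (Suc j)
  let ?m = "n div q"
  have m1: "q ^ j \<le> ?m"
    using Suc.prems(1) q by (simp add: less_eq_div_iff_mult_less_eq mult.commute)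
  have m2: "?m < q ^ Suc j"
    using Suc.prems(2) by (intro less_mult_imp_div_less) (simp add: mult.commute)
  define r where "r = n - q ^ Suc j"
  have n: "n = r + q * q ^ j"
    using Suc.prems(1) by (simp add: r_def)
  have 1: "n mod q = r mod q"
    by (simp add: n)
  have 2: "n div q - q ^ j = r div q"
    using q by (simp add: n)
  have "content b q n = n mod q + b * (content b q (?m - q ^ j) + b ^ j)"
    using Suc.IH[OF m1 m2] by (subst content_rec[OF q]) simp
  also have "\<dots> = content b q r + b ^ Suc j"
    unfolding 1 2 by (subst (2) content_rec[OF q]) (simp add: algebra_simps)
  finally show ?case
    by (simp only: r_def)
qed

text \<open>The extreme case has all \<open>j\<close> digits equal to \<open>q - 1\<close>, a
  geometric sum; multiplying by \<open>b - 1\<close> keeps the induction free of division.\<close>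

lemma content_less_power:
  assumes q: "q \<ge> 2" and b: "b \<ge> 1"
  shows "n < q ^ j \<Longrightarrow> (real b - 1) * real (content b q n) \<le> (real q - 1) * (real b ^ j - 1)"
proof (induction j arbitrary: n)
  case (Suc j)
  have "n div q < q ^ j"
    using Suc.prems by (intro less_mult_imp_div_less) (simp add: mult.commute)
  from Suc.IH[OF this]
  have "real b * ((real b - 1) * real (content b q (n div q)))
      \<le> real b * ((real q - 1) * (real b ^ j - 1))"
    by (rule mult_left_mono) simp
  moreover have "(real b - 1) * real (n mod q) \<le> (real b - 1) * (real q - 1)"
  proof (rule mult_left_mono)
    have "n mod q < q"
      using q by simp
    then show "real (n mod q) \<le> real q - 1"
      by linarith
  qed (use b in simp)
  ultimately show ?case
    by (subst content_rec[OF q]) (simp add: algebra_simps)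
qed simp

text \<open>If \<open>q ^ l\<close> is the leading place of \<open>n\<close>, then
  \<open>b ^ l\<close> is \<open>q ^ l\<close> raised to \<open>ln b / ln q\<close>. The factor
  \<open>b\<close> in the constant arises because \<open>n\<close> has \<open>l + 1\<close>
  digits.\<close>

lemma content_le_powr:
  assumes b: "b \<ge> 2" and q: "q \<ge> 2" and n: "n \<ge> 1"
  shows "real (content b q n)
    \<le> real b * (real q - 1) / (real b - 1) * real n powr (ln (real b) / ln (real q))"
proof -
  obtain l where l: "q ^ l \<le> n" "n < q ^ (l + 1)"
    using ex_power_ivl1[OF q n] by blast
  let ?e = "ln (real b) / ln (real q)"
  have e: "?e \<ge> 0"
    using b q by simp
  have "real b ^ l = real q powr (?e * real l)"
    using b q by (simp add: powr_def ac_simps flip: powr_realpow)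
  also have "\<dots> = real (q ^ l) powr ?e"
    using q by (simp add: powr_powr ac_simps flip: powr_realpow)
  also have "\<dots> \<le> real n powr ?e"
    using l(1) e by (intro powr_mono2) (simp_all flip: of_nat_power)
  finally have bl: "real b ^ l \<le> real n powr ?e" .
  have "(real b - 1) * real (content b q n) \<le> (real q - 1) * (real b ^ (l + 1) - 1)"
    using content_less_power[OF q _ l(2), of b] b by simp
  also have "\<dots> \<le> (real q - 1) * (real b * real n powr ?e)"
    using mult_left_mono[OF bl, of "real b"] q by (intro mult_left_mono) auto
  finally show ?thesis
    using b by (simp add: field_simps)
qed

section \<open>Linear recursions as annihilators\<close>

text \<open>The polynomial variable acts on sequences as the shift. Satisfying a recursion then
  means being annihilated by its companion polynomial.\<close>

definition shift_apply :: "(nat \<Rightarrow> 'a::comm_ring_1) \<Rightarrow> 'a poly \<Rightarrow> nat \<Rightarrow> 'a" where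
  "shift_apply s P n = (\<Sum>j\<le>degree P. coeff P j * s (n + j))"

lemma shift_apply_cutoff:
  assumes "degree P \<le> N"
  shows "shift_apply s P n = (\<Sum>j\<le>N. coeff P j * s (n + j))"
  unfolding shift_apply_def using assms
  by (intro sum.mono_neutral_left) (auto simp: coeff_eq_0)

lemma shift_apply_0 [simp]: "shift_apply s 0 n = 0"
  by (simp add: shift_apply_def)

lemma shift_apply_add: "shift_apply s (P + R) n = shift_apply s P n + shift_apply s R n"
proof -
  let ?N = "max (degree P) (degree R)"
  have "shift_apply s (P + R) n = (\<Sum>j\<le>?N. coeff (P + R) j * s (n + j))"
    by (rule shift_apply_cutoff) (rule degree_add_le_max)
  then show ?thesis
    by (simp add: shift_apply_cutoff[of P ?N] shift_apply_cutoff[of R ?N]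
        distrib_right sum.distrib)
qed

lemma shift_apply_smult: "shift_apply s (smult u P) n = u * shift_apply s P n"
  using shift_apply_cutoff[OF degree_smult_le[of u P], of s n]
  by (simp add: shift_apply_def sum_distrib_left mult.assoc)

lemma shift_apply_diff: "shift_apply s (P - R) n = shift_apply s P n - shift_apply s R n"
  using shift_apply_add[of s "P - R" R n] by simp

lemma shift_apply_sum: "shift_apply s (\<Sum>i\<in>I. f i) n = (\<Sum>i\<in>I. shift_apply s (f i) n)"
  by (induction I rule: infinite_finite_induct) (simp_all add: shift_apply_add)

lemma shift_apply_monom: "shift_apply s (monom u j) n = u * s (n + j)"
proof -
  have "shift_apply s (monom u j) n = (\<Sum>i\<le>j. coeff (monom u j) i * s (n + i))"
    by (rule shift_apply_cutoff) (rule degree_monom_le)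
  also have "\<dots> = (\<Sum>i\<le>j. if i = j then u * s (n + j) else 0)"
    by (intro sum.cong) auto
  finally show ?thesis
    by simp
qed

lemma shift_apply_pCons_0: "shift_apply s (pCons 0 P) n = shift_apply s P (Suc n)"
proof -
  have "shift_apply s (pCons 0 P) n
      = (\<Sum>j\<le>Suc (degree P). coeff (pCons 0 P) j * s (n + j))"
    by (rule shift_apply_cutoff) (rule degree_pCons_le)
  then show ?thesis
    by (subst (asm) sum.atMost_Suc_shift) (simp add: shift_apply_def)
qed

text \<open>Annihilators form an ideal: multiplying by the variable only shifts a sequence that is
  already zero.\<close>

lemma shift_apply_mult_eq_0:
  assumes "\<And>n. shift_apply s P n = 0"
  shows "shift_apply s (R * P) n = 0"
proof (induction R arbitrary: n)
  case (pCons u R)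
  then show ?case
    by (simp add: shift_apply_add shift_apply_smult shift_apply_pCons_0 assms)
qed simp

lemma shift_apply_companion_poly:
  assumes "satisfies_recursion d a s"
  shows "shift_apply s (companion_poly d a) n = 0"
proof -
  have "s (n + d) = (\<Sum>i=1..d. a i * s (n + d - i))"
    using assms by (simp add: satisfies_recursion_def)
  also have "\<dots> = (\<Sum>i=1..d. a i * s (n + (d - i)))"
    by (intro sum.cong) auto
  finally show ?thesis
    by (simp add: companion_poly_def shift_apply_diff shift_apply_sum shift_apply_monom)
qed

section \<open>Total degree and Frobenius powers\<close>

text \<open>Adding \<open>D\<close> on the left avoids truncated subtraction: for
  \<open>D > d\<close> no nonzero coefficient is left.\<close>

lemma total_degree_coeffD:
  assumes "total_degree R \<le> ereal (real d - real D)" and nz: "coeff (coeff R j) i \<noteq> 0"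
  shows "i + j + D \<le> d"
proof -
  have "R \<noteq> 0"
    using nz by auto
  then have "real (Max {i + j | i j. coeff (coeff R j) i \<noteq> 0}) \<le> real d - real D"
    using assms(1) by (simp add: total_degree_def)
  moreover have "i + j \<le> Max {i + j | i j. coeff (coeff R j) i \<noteq> 0}"
    using nz by (intro Max_ge finite_total_degrees) auto
  ultimately show ?thesis
    by linarith
qed

text \<open>\<open>X + c y\<close> is homogeneous of degree one, so each factor raises the total
  degree by at most one and the gap \<open>D\<close> survives.\<close>

lemma coeff_mult_linear_power:
  fixes R :: "'a::comm_ring_1 poly poly"
  assumes "\<And>i j. coeff (coeff R j) i \<noteq> 0 \<Longrightarrow> i + j + D \<le> d"
  shows "coeff (coeff (R * [:[:0, c:], 1:] ^ e) j) i \<noteq> 0 \<Longrightarrow> i + j + D \<le> d + e"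
proof (induction e arbitrary: i j)
  case 0
  then show ?case
    using assms by simp
next
  case (Suc e)
  let ?S = "R * [:[:0, c:], 1:] ^ e"
  have "R * [:[:0, c:], 1:] ^ Suc e = ?S * [:[:0, c:], 1:]"
    by (simp only: power_Suc2 mult.assoc)
  also have "\<dots> = smult [:0, c:] ?S + pCons 0 ?S"
    by simp
  finally have eq: "R * [:[:0, c:], 1:] ^ Suc e = smult [:0, c:] ?S + pCons 0 ?S" .
  have "coeff ([:0, c:] * coeff ?S j) i \<noteq> 0 \<or> coeff (coeff (pCons 0 ?S) j) i \<noteq> 0"
    using Suc.prems unfolding eq coeff_add coeff_smult by (metis add_0)
  then show ?case
  proof
    assume "coeff ([:0, c:] * coeff ?S j) i \<noteq> 0"
    then have "i \<noteq> 0 \<and> coeff (coeff ?S j) (i - 1) \<noteq> 0"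
      by (cases i) auto
    then show ?thesis
      using Suc.IH[of j "i - 1"] by simp
  next
    assume "coeff (coeff (pCons 0 ?S) j) i \<noteq> 0"
    then have "j \<noteq> 0 \<and> coeff (coeff ?S (j - 1)) i \<noteq> 0"
      by (cases j) auto
    then show ?thesis
      using Suc.IH[of "j - 1" i] by simp
  qed
qed

text \<open>Frobenius applies twice, to the sum over powers of \<open>X\<close> and to each
  coefficient as a sum over powers of \<open>y\<close>; it scales both exponents by \<open>m\<close>
  without mixed terms.\<close>

lemma poly_poly_power_char:
  fixes R :: "'a::comm_ring_1 poly poly"
  assumes "prime CHAR('a)" and m: "m = CHAR('a) ^ e"
  shows "R ^ m = (\<Sum>j\<le>degree R. \<Sum>i\<le>degree (coeff R j).
    monom (monom (coeff (coeff R j) i ^ m) (i * m)) (j * m))"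
proof -
  have "R ^ m = (\<Sum>j\<le>degree R. monom (coeff R j) j) ^ m"
    by (simp add: poly_as_sum_of_monoms)
  also have "\<dots> = (\<Sum>j\<le>degree R. monom (coeff R j ^ m) (j * m))"
    using assms by (subst freshmans_dream_sum') (simp_all add: monom_power)
  also have "\<dots> = (\<Sum>j\<le>degree R. monom ((\<Sum>i\<le>degree (coeff R j).
      monom (coeff (coeff R j) i) i) ^ m) (j * m))"
    by (simp add: poly_as_sum_of_monoms)
  also have "\<dots> = (\<Sum>j\<le>degree R. monom (\<Sum>i\<le>degree (coeff R j).
      monom (coeff (coeff R j) i ^ m) (i * m)) (j * m))"
    using assms by (subst freshmans_dream_sum') (simp_all add: monom_power)
  finally show ?thesis
    by (simp add: monom_sum)
qed

lemma linear_power_char: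
  fixes c :: "'a::comm_ring_1"
  assumes "prime CHAR('a)" and m: "m = CHAR('a) ^ e"
  shows "[:[:0, c:], 1:] ^ m = monom 1 m + monom (monom (c ^ m) m) 0"
proof -
  have "[:[:0, c:], 1:] = monom 1 1 + monom (monom c 1) 0"
    by (simp add: monom_altdef)
  then have "[:[:0, c:], 1:] ^ m = (monom 1 1 + monom (monom c 1) 0) ^ m"
    by simp
  also have "\<dots> = monom 1 m + monom (monom (c ^ m) m) 0"
    using assms by (subst freshmans_dream') (simp_all add: monom_power)
  finally show ?thesis .
qed

section \<open>Content drop\<close>

text \<open>For a zero polynomial the bound is vacuous, so \<open>B\<close> may be smaller than \<open>E\<close>.\<close>
definition content_bounded :: "nat \<Rightarrow> nat \<Rightarrow> nat \<Rightarrow> nat \<Rightarrow> 'a::zero poly \<Rightarrow> bool" where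
  "content_bounded b q E B f \<longleftrightarrow> (\<forall>m. coeff f m \<noteq> 0 \<longrightarrow> content b q m + E \<le> B)"

lemma content_bounded_0: "content_bounded b q E B 0"
  by (simp add: content_bounded_def)

lemma content_bounded_add:
  "content_bounded b q E B f \<Longrightarrow> content_bounded b q E B g \<Longrightarrow> content_bounded b q E B (f + g)"
  unfolding content_bounded_def by (metis add_0 coeff_add)

lemma content_bounded_uminus:
  "content_bounded b q E B (- f) \<longleftrightarrow> content_bounded b q E B (f :: 'a::ring poly)"
  by (simp add: content_bounded_def)

lemma content_bounded_sum:
  "(\<And>i. i \<in> I \<Longrightarrow> content_bounded b q E B (f i)) \<Longrightarrow> content_bounded b q E B (\<Sum>i\<in>I. f i)"
  by (induction I rule: infinite_finite_induct) (simp_all add: content_bounded_0 content_bounded_add)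

lemma content_bounded_mono:
  "content_bounded b q E B f \<Longrightarrow> B \<le> C \<Longrightarrow> content_bounded b q E C f"
  unfolding content_bounded_def by (meson le_trans)

lemma content_bounded_monom_mult:
  fixes f :: "'a::comm_ring_1 poly"
  assumes "q \<ge> 2" "b \<le> q" and "content_bounded b q E B f"
  shows "content_bounded b q E (content b q i + B) (monom u i * f)"
  unfolding content_bounded_def
proof (intro allI impI)
  fix m
  assume "coeff (monom u i * f) m \<noteq> 0"
  then have "i \<le> m" and "coeff f (m - i) \<noteq> 0"
    by (auto simp: coeff_monom_mult split: if_splits)
  then have "content b q (m - i) + E \<le> B"
    using assms(3) by (simp add: content_bounded_def)
  moreover have "content b q (i + (m - i)) \<le> content b q i + content b q (m - i)"
    using assms(1,2) by (rule content_add_le)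
  ultimately show "content b q m + E \<le> content b q i + B"
    using \<open>i \<le> m\<close> by simp
qed

lemma content_bounded_recursion:
  fixes s :: "nat \<Rightarrow> 'a::comm_ring_1 poly" and R :: "'a poly poly"
  assumes char: "prime CHAR('a)" "q = CHAR('a) ^ k"
    and q: "q \<ge> 2" and b: "b < q"
    and R: "\<And>i j. coeff (coeff R j) i \<noteq> 0 \<Longrightarrow> i + j \<le> b"
    and rec: "\<And>n. shift_apply s ([:[:0, c:], 1:] ^ q + R) n = 0"
    and init: "\<And>n. n < q \<Longrightarrow> content_bounded b q E n (s n)"
  shows "content_bounded b q E (content b q n) (s n)"
proof (induction n rule: less_induct)
  case (less n)
  note bq = less_imp_le[OF b]
  show ?case
  proof (cases "n < q")
    case True
    then show ?thesis
      using init q by (simp add: content_less)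
  next
    case False
    obtain l where l: "q ^ l \<le> n" "n < q ^ (l + 1)"
      using ex_power_ivl1[OF q, of n] False q by auto
    with False have "l \<noteq> 0"
      by (auto intro: Nat.gr0I)
    then obtain j where j: "l = Suc j"
      by (cases l) auto
    \<comment> \<open>\<open>q * m\<close> is the leading place of \<open>n\<close>, and
      \<open>m\<close> is a power of the characteristic, so taking \<open>m\<close>-th powers is
      additive.\<close>
    define m where "m = q ^ j"
    define n' where "n' = n - q * m"
    have n: "n = n' + q * m"
      using l(1) by (simp add: n'_def j m_def)
    have mpos: "m > 0"
      using q by (simp add: m_def)
    have cn: "content b q n = content b q n' + b * b ^ j"
      using content_diff_power[OF q, of l n b] l by (simp add: n'_def j m_def)
    have m: "m = CHAR('a) ^ (k * j)" and qm: "q * m = CHAR('a) ^ (k * Suc j)"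
      by (simp_all add: m_def char(2) power_mult power_add)
    define Rm where "Rm = shift_apply s (R ^ m) n'"
    have "([:[:0, c:], 1:] ^ q + R) ^ m = [:[:0, c:], 1:] ^ (q * m) + R ^ m"
      unfolding power_mult using char(1) m
      by (intro freshmans_dream'[where n = "k * j"]) simp_all
    also have "[:[:0, c:], 1:] ^ (q * m) = monom 1 (q * m) + monom (monom (c ^ (q * m)) (q * m)) 0"
      using char(1) qm by (rule linear_power_char)
    finally have "shift_apply s (([:[:0, c:], 1:] ^ q + R) ^ m) n'
        = s n + monom (c ^ (q * m)) (q * m) * s n' + Rm"
      by (simp add: shift_apply_add shift_apply_monom Rm_def n)
    \<comment> \<open>Since \<open>m > 0\<close>, the power still contains the annihilator as a
      factor.\<close>
    moreover have "shift_apply s (([:[:0, c:], 1:] ^ q + R) ^ m) n' = 0"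
    proof -
      have "shift_apply s (([:[:0, c:], 1:] ^ q + R) ^ (m - 1) * ([:[:0, c:], 1:] ^ q + R)) n' = 0"
        by (rule shift_apply_mult_eq_0) (rule rec)
      then show ?thesis
        using mpos by (metis power_minus_mult)
    qed
    ultimately have sn: "s n = - (monom (c ^ (q * m)) (q * m) * s n' + Rm)"
      by (metis add.assoc eq_neg_iff_add_eq_0)
    \<comment> \<open>The exponent \<open>q * m\<close> has content \<open>b ^ (j + 1)\<close>,
      exactly what \<open>n'\<close> lacks compared with \<open>n\<close>.\<close>
    have "content_bounded b q E (content b q n) (monom (c ^ (q * m)) (q * m) * s n')"
    proof -
      have "content b q (q * m) = b * b ^ j"
        using content_mult_power[OF q, of b "Suc j" 1] content_less[of 1 q b] q
        by (simp add: m_def)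
      moreover have "n' < n"
        using mpos q by (simp add: n)
      ultimately show ?thesis
        using content_bounded_monom_mult[OF q bq less.IH[of n'], of "q * m" "c ^ (q * m)"]
        by (simp add: cn add.commute)
    qed
    moreover have "content_bounded b q E (content b q n) Rm"
      unfolding Rm_def poly_poly_power_char[OF char(1) m] shift_apply_sum shift_apply_monom
    proof (intro content_bounded_sum)
      fix v u
      show "content_bounded b q E (content b q n)
        (monom (coeff (coeff R v) u ^ m) (u * m) * s (n' + v * m))"
      proof (cases "coeff (coeff R v) u = 0")
        case True
        then show ?thesis
          using mpos by (simp add: power_0_left content_bounded_0)
      next
        case False
        then have uv: "u + v \<le> b"
          by (rule R)
        have cm: "content b q (w * m) \<le> w * b ^ j" for w
          using content_mult_power[OF q, of b j w] content_le_self[OF q bq, of w]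
          by (simp add: m_def mult.commute)
        \<comment> \<open>\<open>v \<le> b < q\<close> puts the index \<open>n' + v * m\<close>
          below \<open>n\<close>, within reach of the induction hypothesis.\<close>
        have "v * m < q * m"
          using uv b mpos by simp
        then have "content_bounded b q E (content b q (u * m) + content b q (n' + v * m))
            (monom (coeff (coeff R v) u ^ m) (u * m) * s (n' + v * m))"
          by (intro content_bounded_monom_mult[OF q bq] less.IH) (simp add: n)
        then show ?thesis
        proof (rule content_bounded_mono)
          \<comment> \<open>The two multiples of \<open>m\<close> cost at most
            \<open>(u + v) * b ^ j \<le> b ^ (j + 1)\<close>, the content freed by removing the
            leading place.\<close>
          have "content b q (u * m) + content b q (n' + v * m)
              \<le> u * b ^ j + (content b q n' + v * b ^ j)"
            using content_add_le[OF q bq, of n' "v * m"] cm[of u] cm[of v] by linarith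
          also have "\<dots> = content b q n' + (u + v) * b ^ j"
            by (simp add: algebra_simps)
          also have "\<dots> \<le> content b q n"
            using uv by (simp add: cn)
          finally show "content b q (u * m) + content b q (n' + v * m) \<le> content b q n" .
        qed
      qed
    qed
    ultimately show ?thesis
      unfolding sn content_bounded_uminus by (rule content_bounded_add)
  qed
qed

section \<open>From monomials to iterates of \<open>T\<close>\<close>

lemma linear_smult_poly_expand:
  fixes T :: "'a::field poly \<Rightarrow> 'a poly"
  assumes "Vector_Spaces.linear smult smult T"
  shows "T f = (\<Sum>i\<le>degree f. smult (coeff f i) (T (monom 1 i)))"
proof -
  interpret T: Vector_Spaces.linear smult smult T
    by (rule assms)
  have "T f = T (\<Sum>i\<le>degree f. smult (coeff f i) (monom 1 i))"
    by (simp add: smult_monom poly_as_sum_of_monoms)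
  then show ?thesis
    by (simp add: T.sum T.scale)
qed

text \<open>Each application of \<open>T\<close> costs every surviving exponent at least
  \<open>E\<close> of content. Recording the loss as slack below a fixed \<open>B\<close> lets the
  steps add up.\<close>

lemma content_bounded_funpow:
  fixes T :: "'a::field poly \<Rightarrow> 'a poly"
  assumes lin: "Vector_Spaces.linear smult smult T"
    and drop: "\<And>n. content_bounded b q E (content b q n) (T (monom 1 n))"
    and f: "content_bounded b q 0 B f"
  shows "content_bounded b q (k * E) B ((T ^^ k) f)"
proof (induction k)
  case 0
  then show ?case
    using f by simp
next
  case (Suc k)
  let ?g = "(T ^^ k) f"
  have "content_bounded b q (Suc k * E) B (smult (coeff ?g i) (T (monom 1 i)))" for i
  proof (cases "coeff ?g i = 0")
    case False
    then have "content b q i + k * E \<le> B"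
      using Suc by (simp add: content_bounded_def)
    then show ?thesis
      using drop[of i] by (fastforce simp: content_bounded_def)
  qed (simp add: content_bounded_0)
  then have "content_bounded b q (Suc k * E) B (T ?g)"
    by (subst linear_smult_poly_expand[OF lin]) (intro content_bounded_sum)
  then show ?case
    by simp
qed

section \<open>The nilpotence bound from the largest content\<close>

theorem theorem10p1:
  fixes T :: "'a::field poly \<Rightarrow> 'a poly"
    and a :: "nat \<Rightarrow> 'a poly"
    and c :: 'a
    and p k q d D E :: nat
  assumes "prime p" and "CHAR('a) = p" and "q = p ^ k"
    and "Vector_Spaces.linear smult smult T"
    and "E \<ge> 1" and "\<forall>f. edegree (T f) \<le> edegree f - ereal (real E)"
    and "satisfies_recursion d a (\<lambda>n. T (monom 1 n))"
    and "total_degree (companion_poly d a - [:[:0, c:], 1:] ^ d) \<le> ereal (real d - real D)"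
    and "d \<le> q" and "D \<ge> 1" and "int q - int D \<ge> 2"
  shows "\<forall>f. nilpotence_order T f \<le>
    ereal ((real q - real D) * (real q - 1) / (real E * (real q - real D - 1)))
      * epowr (edegree f) (ln (real q - real D) / ln (real q))"
proof
  fix f :: "'a poly"
  define b where "b = q - D"
  have b: "b \<ge> 2" "b < q" "real q - real D = real b" and q: "q \<ge> 2"
    using assms(10,11) by (auto simp: b_def)
  define s where "s = (\<lambda>n. T (monom 1 n))"
  define L where "L = [:[:0, c:], 1:]"
  \<comment> \<open>The factor \<open>L ^ (q - d)\<close> raises the order of the recursion from
    \<open>d\<close> to \<open>q\<close>, a power of the characteristic, while the remainder has
    total degree at most \<open>q - D = b\<close>.\<close>
  define R where "R = (companion_poly d a - L ^ d) * L ^ (q - d)"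
  have "coeff (coeff R j) i \<noteq> 0 \<Longrightarrow> i + j + D \<le> d + (q - d)" for i j
    unfolding R_def L_def
    by (rule coeff_mult_linear_power) (rule total_degree_coeffD[OF assms(8)])
  then have R: "coeff (coeff R j) i \<noteq> 0 \<Longrightarrow> i + j \<le> b" for i j
    using assms(9) by (fastforce simp: b_def)
  have "L ^ q = L ^ (q - d) * L ^ d"
    using assms(9) by (simp flip: power_add)
  then have "L ^ q + R = L ^ (q - d) * companion_poly d a"
    by (simp add: R_def algebra_simps)
  then have rec: "shift_apply s (L ^ q + R) n = 0" for n
    using shift_apply_mult_eq_0 shift_apply_companion_poly[OF assms(7)] unfolding s_def by metis
  \<comment> \<open>Below \<open>q\<close> a number is its own content, so the degree drop of
    \<open>T\<close> and \<open>content_le_self\<close> supply the initial values.\<close>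
  have init: "content_bounded b q E n (s n)" if "n < q" for n
    unfolding content_bounded_def
  proof (intro allI impI)
    fix m
    assume m: "coeff (s n) m \<noteq> 0"
    then have "s n \<noteq> 0" and md: "m \<le> degree (s n)"
      by (auto intro: le_degree)
    then have "real (degree (s n)) \<le> real n - real E"
      using assms(6)[rule_format, of "monom 1 n"]
      by (simp add: edegree_def s_def degree_monom_eq)
    then have "m + E \<le> n"
      using md by linarith
    then show "content b q m + E \<le> n"
      using content_le_self[OF q less_imp_le[OF b(2)], of m] by simp
  qed
  have drop: "content_bounded b q E (content b q n) (T (monom 1 n))" for n
    using content_bounded_recursion[of q k b R s c E n] assms(1-3) q b(2) R rec init
    by (simp add: s_def L_def)
  let ?C = "real b * (real q - 1) / (real b - 1)" and ?e = "ln (real b) / ln (real q)"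
  have C: "?C > 0" and e: "?e > 0"
    using b q by auto
  have const: "(real q - real D) * (real q - 1) / (real E * (real q - real D - 1)) = ?C / real E"
    unfolding b(3) by simp
  show "nilpotence_order T f \<le>
    ereal ((real q - real D) * (real q - 1) / (real E * (real q - real D - 1)))
      * epowr (edegree f) (ln (real q - real D) / ln (real q))"
  proof (cases "f = 0")
    case True
    then show ?thesis
      by (simp add: nilpotence_order_def)
  next
    case False
    let ?K = "{k. (T ^^ k) f \<noteq> 0}"
    have fin: "finite ?K"
      using assms(5,6) by (intro finite_nonvanishing) auto
    have "Max ?K \<in> ?K"
      using fin False by (intro Max_in) (auto intro: exI[of _ 0])
    then have "(T ^^ Max ?K) f \<noteq> 0"
      by simp
    then obtain m where m: "coeff ((T ^^ Max ?K) f) m \<noteq> 0"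
      by (metis leading_coeff_0_iff)
    \<comment> \<open>Content need not increase with its argument, so the maximum runs over all
      exponents up to the degree.\<close>
    define B where "B = Max (content b q ` {..degree f})"
    have "content_bounded b q 0 B f"
      unfolding content_bounded_def B_def by (auto intro!: Max_ge imageI le_degree)
    \<comment> \<open>The last nonvanishing iterate has a nonzero coefficient; its content is
      nonnegative, so the accumulated loss cannot exceed \<open>B\<close>.\<close>
    from content_bounded_funpow[OF assms(4) drop this] m have KB: "Max ?K * E \<le> B"
      by (fastforce simp: content_bounded_def)
    have "B \<in> content b q ` {..degree f}"
      unfolding B_def by (intro Max_in) auto
    then obtain n where n: "n \<le> degree f" "B = content b q n"
      by auto
    have "real B \<le> ?C * real (degree f) powr ?e"
    \<comment> \<open>\<open>content_le_powr\<close> needs a positive argument. At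
      \<open>n = 0\<close> the content vanishes, which also covers constant \<open>f\<close>, where
      \<open>0 powr ?e = 0\<close>.\<close>
    proof (cases "n = 0")
      case True
      then have "real B = 0"
        using n by simp
      then show ?thesis
        using C by (simp only: mult_nonneg_nonneg less_imp_le powr_ge_zero)
    next
      case False
      then have "real B \<le> ?C * real n powr ?e"
        unfolding n(2) using b q by (intro content_le_powr) auto
      also have "\<dots> \<le> ?C * real (degree f) powr ?e"
        using C e n(1) by (intro mult_left_mono powr_mono2) auto
      finally show ?thesis .
    qed
    then have "real (Max ?K) * real E \<le> ?C * real (degree f) powr ?e"
      using KB by (simp flip: of_nat_mult)
    then have "real (Max ?K) \<le> ?C * real (degree f) powr ?e / real E"
      using assms(5) by (subst pos_le_divide_eq) simp_all
    also have "\<dots> = ?C / real E * real (degree f) powr ?e"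
      by simp
    finally have "real (Max ?K) \<le> ?C / real E * real (degree f) powr ?e" .
    then show ?thesis
      unfolding const using False
      by (simp add: nilpotence_order_def edegree_def epowr_def b(3))
  qed
qed

end
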